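(* Let $(X, p)$ be a compact pseudometric space, and let $T : X \to X$ be a homeomorphism. Let $\mu$ be a regular Borel probability measure on $X$. Fix a point $x_0 \in X$, and for each $j \in \mathbb{Z}$, $r \in [0, \infty)$, let $$D_{x_0}(j, r) = \sup\left\{ p\left( T^j x_0, T^j x \right) : x \in X,\ p(x_0, x) \leq r \right\} .$$ Let $\mathbf{F} = (F_k)_{k=1}^\infty$ be a sequence of finite nonempty subsets of $\mathbb{Z}$. Let $a = (a_k)_{k \in \mathbb{Z}} \in M^{\mathbf{F}}$, and let $(C_k)_{k=1}^\infty$ be a sequence of measurable subsets of $X$ such that $\mu(C_k) > 0$ and $x_0 \in C_k$ for all $k \in \mathbb{N}$. Suppose that for every $\delta > 0$, $$\lim_{k \to \infty} \frac{1}{|F_k|} \sum_{j \in F_k,\ D_{x_0}(j, \operatorname{diam}(C_k)) > \delta} |a_j| = 0 .$$ Let $f : X \to \mathbb{C}$ be a continuous function. Finally, suppose there exists a constant $\lambda > 0$ such that $\mu\left( T^j C_k \right) \leq \lambda \mu(C_k)$ for all $j \in \mathbb{N}$ and all $k \in \mathbb{N}$. Then $$\lim_{k \to \infty} \left| \left( \operatorname{Avg}_{F_k}^a f \right)(x_0) - \alpha_{C_k}\left( \operatorname{Avg}_{F_k}^a f \right) \right| = 0 .$$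
   Context: For a sequence $\mathbf{F} = (F_k)_{k=1}^\infty$ of finite nonempty subsets of $\mathbb{Z}$, $M^{\mathbf{F}} = \left\{ (a_k)_{k \in \mathbb{Z}} \in \mathbb{C}^{\mathbb{Z}} : \sup_{\ell \in \mathbb{N}} \frac{1}{|F_\ell|} \sum_{j \in F_\ell} |a_j| < \infty \right\}$. For a finite nonempty $F \subseteq \mathbb{Z}$ and $a \in \mathbb{C}^{\mathbb{Z}}$, $\operatorname{Avg}_F^a f = \frac{1}{|F|} \sum_{j \in F} a_j \, (f \circ T^j)$. For a measurable $C \subseteq X$ with $\mu(C)>0$, $\alpha_C(h) = \frac{1}{\mu(C)} \int_C h \, \mathrm{d}\mu$. $\operatorname{diam}(C) = \sup_{x,y \in C} p(x,y)$. *)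

theory Defs
  imports "HOL-Probability.Probability"
begin

section \<open>Pseudometric spaces\<close>

text \<open>As \<open>Metric_space\<close>, but distinct points may be at distance zero.\<close>

locale pseudometric_space =
  fixes X :: "'a set" and p :: "'a \<Rightarrow> 'a \<Rightarrow> real"
  assumes nonneg: "\<And>x y. \<lbrakk>x \<in> X; y \<in> X\<rbrakk> \<Longrightarrow> 0 \<le> p x y"
    and self: "\<And>x. x \<in> X \<Longrightarrow> p x x = 0"
    and commute: "\<And>x y. \<lbrakk>x \<in> X; y \<in> X\<rbrakk> \<Longrightarrow> p x y = p y x"
    and triangle: "\<And>x y z. \<lbrakk>x \<in> X; y \<in> X; z \<in> X\<rbrakk> \<Longrightarrow> p x z \<le> p x y + p y z"

definition pm_topology :: "'a set \<Rightarrow> ('a \<Rightarrow> 'a \<Rightarrow> real) \<Rightarrow> 'a topology" where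
  "pm_topology X p =
     topology (\<lambda>U. U \<subseteq> X \<and> (\<forall>x\<in>U. \<exists>r>0. {y \<in> X. p x y < r} \<subseteq> U))"

lemma openin_pm_topology:
  "openin (pm_topology X p) U \<longleftrightarrow>
     U \<subseteq> X \<and> (\<forall>x\<in>U. \<exists>r>0. {y \<in> X. p x y < r} \<subseteq> U)"
proof -
  have "istopology (\<lambda>U. U \<subseteq> X \<and> (\<forall>x\<in>U. \<exists>r>0. {y \<in> X. p x y < r} \<subseteq> U))"
    unfolding istopology_def
  proof (intro conjI allI impI)
    fix S T
    assume S: "S \<subseteq> X \<and> (\<forall>x\<in>S. \<exists>r>0. {y \<in> X. p x y < r} \<subseteq> S)"
      and T: "T \<subseteq> X \<and> (\<forall>x\<in>T. \<exists>r>0. {y \<in> X. p x y < r} \<subseteq> T)"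
    show "S \<inter> T \<subseteq> X" using S by blast
    show "\<forall>x\<in>S \<inter> T. \<exists>r>0. {y \<in> X. p x y < r} \<subseteq> S \<inter> T"
    proof
      fix x assume x: "x \<in> S \<inter> T"
      obtain r where r: "r > 0" "{y \<in> X. p x y < r} \<subseteq> S" using S x by blast
      obtain s where s: "s > 0" "{y \<in> X. p x y < s} \<subseteq> T" using T x by blast
      have "min r s > 0" "{y \<in> X. p x y < min r s} \<subseteq> S \<inter> T"
        using r s by auto
      then show "\<exists>r>0. {y \<in> X. p x y < r} \<subseteq> S \<inter> T" by blast
    qed
  next
    fix K
    assume K: "\<forall>S\<in>K. S \<subseteq> X \<and> (\<forall>x\<in>S. \<exists>r>0. {y \<in> X. p x y < r} \<subseteq> S)"
    show "\<Union>K \<subseteq> X" using K by blast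
    show "\<forall>x\<in>\<Union>K. \<exists>r>0. {y \<in> X. p x y < r} \<subseteq> \<Union>K"
      using K by (meson Union_upper UnionE order_trans)
  qed
  then show ?thesis by (simp add: pm_topology_def)
qed

lemma topspace_pm_topology [simp]: "topspace (pm_topology X p) = X"
proof -
  have "openin (pm_topology X p) X"
    unfolding openin_pm_topology by (auto intro: exI[of _ 1])
  then show ?thesis
    by (metis openin_pm_topology openin_subset openin_topspace subset_antisym)
qed

text \<open>A real supremum, so meaningful only for nonempty \<open>C\<close> with bounded distances; both
  hold for the sets considered here, which contain \<open>x0\<close> and lie in a compact space.\<close>

definition pm_diam :: "('a \<Rightarrow> 'a \<Rightarrow> real) \<Rightarrow> 'a set \<Rightarrow> real" where
  "pm_diam p C = (SUP (x, y) \<in> C \<times> C. p x y)"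

section \<open>Regular Borel measures\<close>

definition borel_measure_on :: "'a topology \<Rightarrow> 'a measure \<Rightarrow> bool" where
  "borel_measure_on \<tau> M \<longleftrightarrow> space M = topspace \<tau> \<and>
     sets M = sigma_sets (topspace \<tau>) {U. openin \<tau> U}"

text \<open>In a space that is not Hausdorff a compact set need not be closed, nor even Borel; the
  inner approximation is by closed compact sets. In a pseudometric space this is the same as
  approximating by all Borel compact sets, because a Borel set contains the closure of each of
  its compact subsets.\<close>

definition regular_measure_on :: "'a topology \<Rightarrow> 'a measure \<Rightarrow> bool" where
  "regular_measure_on \<tau> M \<longleftrightarrow> (\<forall>A \<in> sets M.
     emeasure M A = (SUP K \<in> {K. K \<subseteq> A \<and> closedin \<tau> K \<and> compactin \<tau> K}. emeasure M K) \<and>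
     emeasure M A = (INF U \<in> {U. A \<subseteq> U \<and> openin \<tau> U}. emeasure M U))"

section \<open>Averages\<close>

text \<open>The power \<open>T\<^sup>j\<close>, for \<open>j\<close> any integer, of a bijection \<open>T\<close> of \<open>X\<close>.\<close>

definition ziter :: "'a set \<Rightarrow> ('a \<Rightarrow> 'a) \<Rightarrow> int \<Rightarrow> 'a \<Rightarrow> 'a" where
  "ziter X T j = (if 0 \<le> j then T ^^ nat j else inv_into X T ^^ nat (- j))"

definition orbit_dev ::
    "'a set \<Rightarrow> ('a \<Rightarrow> 'a \<Rightarrow> real) \<Rightarrow> ('a \<Rightarrow> 'a) \<Rightarrow> 'a \<Rightarrow> int \<Rightarrow> real \<Rightarrow> real" where
  "orbit_dev X p T x0 j r =
     (SUP x \<in> {x \<in> X. p x0 x \<le> r}. p (ziter X T j x0) (ziter X T j x))"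

text \<open>Sequences indexed by \<open>k = 1, 2, \<dots>\<close> are functions on \<open>nat\<close> whose value at \<open>0\<close> is
  disregarded. The supremum is taken in the extended reals, so that it may be infinite.\<close>

definition M_space :: "(nat \<Rightarrow> int set) \<Rightarrow> (int \<Rightarrow> complex) set" where
  "M_space F = {a. (SUP l \<in> {1..}. ereal ((\<Sum>j\<in>F l. cmod (a j)) / real (card (F l)))) < \<infinity>}"

definition Avg ::
    "'a set \<Rightarrow> ('a \<Rightarrow> 'a) \<Rightarrow> int set \<Rightarrow> (int \<Rightarrow> complex) \<Rightarrow> ('a \<Rightarrow> complex) \<Rightarrow> 'a \<Rightarrow> complex" where
  "Avg X T F a f = (\<lambda>x. (\<Sum>j\<in>F. a j * f (ziter X T j x)) / of_nat (card F))"

definition set_avg :: "'a measure \<Rightarrow> 'a set \<Rightarrow> ('a \<Rightarrow> complex) \<Rightarrow> complex" where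
  "set_avg M C h = (LINT x:C|M. h x) / of_real (measure M C)"

end

theory Submission
  imports Defs
begin

text \<open>
  On the compact space \<open>X\<close> the function \<open>f\<close> is uniformly continuous, and every \<open>x \<in> C k\<close> is within
  \<open>diam (C k)\<close> of \<open>x0\<close>. In \<open>Avg f x0 - Avg f x\<close>, the terms with \<open>D(j, diam (C k)) \<le> \<delta>\<close> are therefore
  at most \<open>\<epsilon> \<bar>a j\<bar>\<close>, and the remaining ones are at most \<open>2 (sup \<bar>f\<bar>) \<bar>a j\<bar>\<close>, with small average by
  hypothesis. The resulting bound is uniform over \<open>x \<in> C k\<close>, so it survives averaging over \<open>C k\<close>.
\<close>

section \<open>Compactness in pseudometric spaces\<close>

context pseudometric_space
begin

lemma openin_pm_ball:
  assumes "x \<in> X"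
  shows "openin (pm_topology X p) {y \<in> X. p x y < r}"
  unfolding openin_pm_topology
proof (intro conjI ballI)
  fix y assume y: "y \<in> {y \<in> X. p x y < r}"
  have "{z \<in> X. p y z < r - p x y} \<subseteq> {z \<in> X. p x z < r}"
    using triangle[of x y] assms y by fastforce
  then show "\<exists>s>0. {z \<in> X. p y z < s} \<subseteq> {z \<in> X. p x z < r}"
    using y by (intro exI[of _ "r - p x y"]) auto
qed auto

text \<open>The radius may vary with the centre: a constant radius gives boundedness, while radii
  adapted to a function give uniform continuity.\<close>

lemma compact_pm_finite_cover:
  assumes "compact_space (pm_topology X p)" and r: "\<And>x. x \<in> X \<Longrightarrow> 0 < r x"
  obtains N where "finite N" "N \<subseteq> X" "\<And>y. y \<in> X \<Longrightarrow> \<exists>x\<in>N. p x y < r x"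
proof -
  let ?B = "\<lambda>x. {y \<in> X. p x y < r x}"
  have "X \<subseteq> \<Union>(?B ` X)" using r self by auto
  moreover have "\<forall>U\<in>?B ` X. openin (pm_topology X p) U"
    using openin_pm_ball by blast
  moreover have "compactin (pm_topology X p) X"
    using assms(1) by (simp add: compact_space_def)
  ultimately obtain \<F> where \<F>: "finite \<F>" "\<F> \<subseteq> ?B ` X" "X \<subseteq> \<Union>\<F>"
    unfolding compactin_def by meson
  then obtain N where N: "N \<subseteq> X" "finite N" "\<F> = ?B ` N"
    by (meson finite_subset_image)
  have "\<exists>x\<in>N. p x y < r x" if "y \<in> X" for y
    using \<F>(3) N(3) that by auto
  with N that show thesis by blast
qed

lemma compact_pm_bounded:
  assumes "compact_space (pm_topology X p)"
  obtains K where "\<And>x y. \<lbrakk>x \<in> X; y \<in> X\<rbrakk> \<Longrightarrow> p x y \<le> K"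
proof -
  obtain N where N: "finite N" "N \<subseteq> X" "\<And>y. y \<in> X \<Longrightarrow> \<exists>x\<in>N. p x y < 1"
    using compact_pm_finite_cover[OF assms, of "\<lambda>_. 1"] by auto
  \<comment> \<open>Distances are nonnegative, so the sum over all pairs of centres dominates each
    of them, and it also makes sense when \<open>N\<close> is empty.\<close>
  define m where "m = (\<Sum>(u, v)\<in>N \<times> N. p u v)"
  have "p x y \<le> m + 2" if xy: "x \<in> X" "y \<in> X" for x y
  proof -
    obtain u v where uv: "u \<in> N" "p u x < 1" "v \<in> N" "p v y < 1"
      using N(3) xy by meson
    have "(\<lambda>(u, v). p u v) (u, v) \<le> m"
      unfolding m_def by (rule member_le_sum) (use uv N nonneg in \<open>auto simp: subset_iff\<close>)
    moreover have "p x y \<le> p x u + (p u v + p v y)"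
      using triangle[of x u y] triangle[of u v y] uv N(2) xy by fastforce
    ultimately show ?thesis using uv commute[of x u] N(2) xy by auto
  qed
  then show thesis by (rule that)
qed

text \<open>A Lebesgue number argument. A point within \<delta> of a point of a covering ball still
  lies in the concentric ball of twice the radius, where \<open>f\<close> stays within \<epsilon>/2
  of its value at the centre.\<close>

lemma compact_pm_uniformly_continuous:
  fixes f :: "'a \<Rightarrow> 'b::metric_space"
  assumes "compact_space (pm_topology X p)"
    and f: "continuous_map (pm_topology X p) euclidean f"
    and "0 < \<epsilon>"
  obtains \<delta> where "0 < \<delta>" "\<And>x y. \<lbrakk>x \<in> X; y \<in> X; p x y \<le> \<delta>\<rbrakk> \<Longrightarrow> dist (f x) (f y) < \<epsilon>"
proof -
  have "\<exists>r>0. \<forall>y\<in>X. p x y < 2 * r \<longrightarrow> dist (f x) (f y) < \<epsilon> / 2" if "x \<in> X" for x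
  proof -
    have "openin (pm_topology X p) {y \<in> X. f y \<in> ball (f x) (\<epsilon> / 2)}"
      using openin_continuous_map_preimage[OF f, of "ball (f x) (\<epsilon> / 2)"] by simp
    moreover have "x \<in> {y \<in> X. f y \<in> ball (f x) (\<epsilon> / 2)}"
      using that \<open>0 < \<epsilon>\<close> by simp
    ultimately obtain r where "r > 0" "{y \<in> X. p x y < r} \<subseteq> {y \<in> X. f y \<in> ball (f x) (\<epsilon> / 2)}"
      unfolding openin_pm_topology by blast
    then show ?thesis by (intro exI[of _ "r / 2"]) auto
  qed
  then obtain r where r: "\<And>x. x \<in> X \<Longrightarrow> 0 < r x"
    "\<And>x y. \<lbrakk>x \<in> X; y \<in> X; p x y < 2 * r x\<rbrakk> \<Longrightarrow> dist (f x) (f y) < \<epsilon> / 2"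
    by metis
  obtain N where N: "finite N" "N \<subseteq> X" "\<And>y. y \<in> X \<Longrightarrow> \<exists>x\<in>N. p x y < r x"
    using compact_pm_finite_cover[OF assms(1), of r] r(1) by auto
  define \<delta> where "\<delta> = Min (insert 1 (r ` N)) / 2"
  have "0 < \<delta>" using N r(1) by (auto simp: \<delta>_def)
  have \<delta>: "\<delta> < r x" if "x \<in> N" for x
  proof -
    have "Min (insert 1 (r ` N)) \<le> r x" using N that by (intro Min_le) auto
    then show ?thesis using \<open>0 < \<delta>\<close> by (simp add: \<delta>_def)
  qed
  have "dist (f x) (f y) < \<epsilon>" if xy: "x \<in> X" "y \<in> X" "p x y \<le> \<delta>" for x y
  proof -
    obtain u where u: "u \<in> N" "p u x < r u" using N(3) xy by meson
    have uX: "u \<in> X" using u N(2) by blast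
    have "p u y < 2 * r u"
      using triangle[of u x y] \<delta>[OF u(1)] u xy uX by linarith
    then have "dist (f u) (f y) < \<epsilon> / 2" using r(2) uX xy by blast
    moreover have "dist (f u) (f x) < \<epsilon> / 2" using r u uX xy by fastforce
    ultimately show ?thesis using dist_triangle_half_r by blast
  qed
  with \<open>0 < \<delta>\<close> that show thesis by blast
qed

text \<open>A real supremum dominates its members only if they are bounded above; compactness
  supplies the bound, here and for \<open>orbit_dev\<close> below.\<close>

lemma le_pm_diam:
  assumes "compact_space (pm_topology X p)" "C \<subseteq> X" "x \<in> C" "y \<in> C"
  shows "p x y \<le> pm_diam p C"
proof -
  obtain K where "\<And>x y. \<lbrakk>x \<in> X; y \<in> X\<rbrakk> \<Longrightarrow> p x y \<le> K"
    using compact_pm_bounded[OF assms(1)] by blast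
  then have "bdd_above ((\<lambda>(x, y). p x y) ` (C \<times> C))"
    using assms(2) by (intro bdd_aboveI[of _ K]) auto
  then show ?thesis
    unfolding pm_diam_def using assms by (intro cSUP_upper2[of _ _ "(x, y)"]) auto
qed

lemma le_orbit_dev:
  assumes "compact_space (pm_topology X p)" "ziter X T j ` X \<subseteq> X"
    and "x0 \<in> X" "x \<in> X" "p x0 x \<le> r"
  shows "p (ziter X T j x0) (ziter X T j x) \<le> orbit_dev X p T x0 j r"
proof -
  obtain K where "\<And>x y. \<lbrakk>x \<in> X; y \<in> X\<rbrakk> \<Longrightarrow> p x y \<le> K"
    using compact_pm_bounded[OF assms(1)] by blast
  then have "bdd_above ((\<lambda>x. p (ziter X T j x0) (ziter X T j x)) ` {x \<in> X. p x0 x \<le> r})"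
    using assms(2,3) by (intro bdd_aboveI[of _ K]) auto
  then show ?thesis
    unfolding orbit_dev_def using assms by (intro cSUP_upper) auto
qed

end

section \<open>Continuity of the iterates and Borel measurability\<close>

lemma continuous_map_funpow:
  assumes "continuous_map \<tau> \<tau> g"
  shows "continuous_map \<tau> \<tau> (g ^^ n)"
proof (induction n)
  case (Suc n)
  then show ?case using continuous_map_compose[OF Suc assms] by (simp add: comp_def)
qed (simp add: id_def)

lemma continuous_map_ziter:
  assumes "homeomorphic_map \<tau> \<tau> T" "topspace \<tau> = X"
  shows "continuous_map \<tau> \<tau> (ziter X T j)"
proof -
  obtain g where g: "homeomorphic_maps \<tau> \<tau> T g"
    using assms(1) homeomorphic_map_maps by blast
  have "inj_on T X" "T ` X = X"
    using assms by (auto simp: homeomorphic_eq_everything_map)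
  \<comment> \<open>Off \<open>X\<close> the two inverses may differ, but continuity concerns only
    their values on the topspace.\<close>
  then have "inv_into X T y = g y" if "y \<in> X" for y
    using g that assms(2) unfolding homeomorphic_maps_def continuous_map_def
    by (intro inv_into_f_eq) auto
  then have "continuous_map \<tau> \<tau> (inv_into X T)"
    using g assms(2) continuous_map_eq[of \<tau> \<tau> g "inv_into X T"]
    by (simp add: homeomorphic_maps_def)
  moreover have "continuous_map \<tau> \<tau> T"
    using assms(1) homeomorphic_imp_continuous_map by blast
  ultimately show ?thesis by (simp add: ziter_def continuous_map_funpow)
qed

lemma borel_measurable_continuous_map:
  fixes f :: "'a \<Rightarrow> 'b::topological_space"
  assumes "borel_measure_on \<tau> M" "continuous_map \<tau> euclidean f"
  shows "f \<in> borel_measurable M"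
proof (rule borel_measurableI)
  fix S :: "'b set" assume "open S"
  then have "openin \<tau> {x \<in> topspace \<tau>. f x \<in> S}"
    using assms(2) openin_continuous_map_preimage by fastforce
  moreover have "f -` S \<inter> space M = {x \<in> topspace \<tau>. f x \<in> S}"
    using assms(1) by (auto simp: borel_measure_on_def)
  ultimately show "f -` S \<inter> space M \<in> sets M"
    using assms(1) by (simp add: borel_measure_on_def)
qed

section \<open>Estimates for averages\<close>

text \<open>The constant \<open>z\<close> is its own average over \<open>C\<close>, so the
  difference is the average of \<open>z - h\<close>, whose modulus is at most \<open>b\<close> on
  \<open>C\<close>.\<close>

lemma (in finite_measure) cmod_diff_set_avg_le:
  assumes h: "h \<in> borel_measurable M" and C: "C \<in> sets M" "0 < measure M C"
    and b: "\<And>x. x \<in> C \<Longrightarrow> cmod (z - h x) \<le> b"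
  shows "cmod (z - set_avg M C h) \<le> b"
proof -
  have const: "set_integrable M C (\<lambda>_. w)" for w :: "'c :: {banach, second_countable_topology}"
    unfolding set_integrable_def
    by (intro integrable_scaleR_left integrable_real_indicator)
      (use C in \<open>auto simp: top.not_eq_extremum[symmetric]\<close>)
  \<comment> \<open>Integrability of \<open>h\<close> is not assumed. The bound on \<open>C\<close>,
    a set of finite measure, gives it for \<open>z - h\<close>, and then
    \<open>h = z - (z - h)\<close> inherits it.\<close>
  have zh: "set_integrable M C (\<lambda>x. z - h x)"
    by (rule set_integrable_bound[OF const[of b]])
      (use h C b in \<open>auto simp: set_borel_measurable_def intro!: AE_I2 order_trans[OF b]\<close>)
  have "set_integrable M C h"
    using set_integral_diff(1)[OF const[of z] zh] by simp
  then have "(LINT x:C|M. z - h x) = measure M C *\<^sub>R z - (LINT x:C|M. h x)"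
    using set_integral_diff(2)[OF const[of z]] C
    by (simp add: set_integral_const emeasure_finite less_top)
  then have "z - set_avg M C h = (LINT x:C|M. z - h x) / of_real (measure M C)"
    using C by (simp add: set_avg_def diff_divide_distrib scaleR_conv_of_real)
  moreover have "cmod (LINT x:C|M. z - h x) \<le> (LINT x:C|M. cmod (z - h x))"
    using set_integral_norm_bound[OF zh] .
  moreover have "\<dots> \<le> (LINT x:C|M. b)"
    using set_integral_mono[OF set_integrable_norm[OF zh] const[of b]] b by simp
  moreover have "(LINT x:C|M. b) = b * measure M C"
    using C by (simp add: set_integral_const emeasure_finite less_top)
  ultimately show ?thesis
    using C by (simp add: norm_divide divide_le_eq)
qed

text \<open>Turns finiteness of an extended real supremum into a real bound. Taking a natural number
  above the supremum makes nonnegativity immediate.\<close>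

lemma M_space_bound:
  assumes "a \<in> M_space F"
  obtains S where "0 \<le> S" "\<And>k. k \<ge> 1 \<Longrightarrow> (\<Sum>j\<in>F k. cmod (a j)) / real (card (F k)) \<le> S"
proof -
  let ?A = "\<lambda>k. (\<Sum>j\<in>F k. cmod (a j)) / real (card (F k))"
  have "(SUP l \<in> {1..}. ereal (?A l)) \<noteq> \<infinity>"
    using assms by (simp add: M_space_def)
  then obtain n :: nat where n: "(SUP l \<in> {1..}. ereal (?A l)) < ereal (real n)"
    unfolding less_PInf_Ex_of_nat by blast
  have "?A k \<le> real n" if "k \<ge> 1" for k
  proof -
    have "ereal (?A k) \<le> (SUP l \<in> {1..}. ereal (?A l))"
      using that by (intro SUP_upper) auto
    with n have "ereal (?A k) < ereal (real n)" by (rule le_less_trans[rotated])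
    then show ?thesis by simp
  qed
  with of_nat_0_le_iff show thesis by (rule that)
qed

text \<open>Here \<open>P\<close> marks the exceptional indices, for which only the crude bound
  \<open>b\<close> is available. The \<open>e\<close> term is summed over all of \<open>F\<close>,
  since the surplus at exceptional indices is nonnegative.\<close>

lemma cmod_Avg_diff_le:
  assumes "finite F" "0 \<le> e"
    and small: "\<And>j. \<lbrakk>j \<in> F; \<not> P j\<rbrakk> \<Longrightarrow> cmod (f (ziter X T j x) - f (ziter X T j y)) \<le> e"
    and large: "\<And>j. j \<in> F \<Longrightarrow> cmod (f (ziter X T j x) - f (ziter X T j y)) \<le> b"
  shows "cmod (Avg X T F a f x - Avg X T F a f y)
    \<le> e * ((\<Sum>j\<in>F. cmod (a j)) / real (card F))
      + b * ((\<Sum>j\<in>{j \<in> F. P j}. cmod (a j)) / real (card F))"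
proof -
  let ?d = "\<lambda>j. f (ziter X T j x) - f (ziter X T j y)"
  have "cmod (\<Sum>j\<in>F. a j * ?d j) \<le> (\<Sum>j\<in>F. cmod (a j) * cmod (?d j))"
    by (rule order_trans[OF norm_sum]) (simp add: norm_mult)
  also have "\<dots> \<le> (\<Sum>j\<in>F. e * cmod (a j) + (if P j then b * cmod (a j) else 0))"
  proof (rule sum_mono)
    fix j assume j: "j \<in> F"
    have "cmod (a j) * cmod (?d j) \<le> cmod (a j) * (if P j then b else e)"
      using small large j by (intro mult_left_mono) auto
    also have "\<dots> \<le> e * cmod (a j) + (if P j then b * cmod (a j) else 0)"
      using assms(2) by (simp add: mult.commute)
    finally show "cmod (a j) * cmod (?d j) \<le> \<dots>" .
  qed
  also have "\<dots> = e * (\<Sum>j\<in>F. cmod (a j)) + b * (\<Sum>j\<in>{j \<in> F. P j}. cmod (a j))"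
    using assms(1) by (simp add: sum.distrib sum_distrib_left sum.inter_filter if_distrib[of "(*) b"] cong: if_cong)
  finally have "cmod (\<Sum>j\<in>F. a j * ?d j) / real (card F)
      \<le> (e * (\<Sum>j\<in>F. cmod (a j)) + b * (\<Sum>j\<in>{j \<in> F. P j}. cmod (a j))) / real (card F)"
    by (rule divide_right_mono) simp
  moreover have "Avg X T F a f x - Avg X T F a f y = (\<Sum>j\<in>F. a j * ?d j) / of_nat (card F)"
    by (simp add: Avg_def right_diff_distrib sum_subtractf diff_divide_distrib)
  ultimately show ?thesis by (simp add: norm_divide add_divide_distrib)
qed

section \<open>Convergence of the averages\<close>

theorem proposition4p6:
  fixes X :: "'a set" and p :: "'a \<Rightarrow> 'a \<Rightarrow> real" and T :: "'a \<Rightarrow> 'a"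
    and \<mu> :: "'a measure" and x0 :: 'a
    and F :: "nat \<Rightarrow> int set" and a :: "int \<Rightarrow> complex" and C :: "nat \<Rightarrow> 'a set"
    and f :: "'a \<Rightarrow> complex"
  assumes "pseudometric_space X p"
    and "compact_space (pm_topology X p)"
    and "homeomorphic_map (pm_topology X p) (pm_topology X p) T"
    and "prob_space \<mu>"
    and "borel_measure_on (pm_topology X p) \<mu>"
    and "regular_measure_on (pm_topology X p) \<mu>"
    and "x0 \<in> X"
    and "\<And>k. k \<ge> 1 \<Longrightarrow> finite (F k) \<and> F k \<noteq> {}"
    and "a \<in> M_space F"
    and "\<And>k. k \<ge> 1 \<Longrightarrow> C k \<in> sets \<mu> \<and> measure \<mu> (C k) > 0 \<and> x0 \<in> C k"
    and "\<And>\<delta>::real. \<delta> > 0 \<Longrightarrow>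
          (\<lambda>k. (\<Sum>j \<in> {j \<in> F k. orbit_dev X p T x0 j (pm_diam p (C k)) > \<delta>}. cmod (a j))
                 / real (card (F k))) \<longlonglongrightarrow> 0"
    and "continuous_map (pm_topology X p) euclidean f"
    and "\<exists>c::real. c > 0 \<and> (\<forall>j\<ge>1. \<forall>k\<ge>1.
          measure \<mu> (ziter X T (int j) ` C k) \<le> c * measure \<mu> (C k))"
  shows "(\<lambda>k. cmod (Avg X T (F k) a f x0 - set_avg \<mu> (C k) (Avg X T (F k) a f))) \<longlonglongrightarrow> 0"
proof -
  interpret pseudometric_space X p by fact
  interpret prob_space \<mu> by fact
  let ?\<tau> = "pm_topology X p"
  have zc: "continuous_map ?\<tau> ?\<tau> (ziter X T j)" for j
    using assms(3) by (rule continuous_map_ziter) simp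
  then have zX: "ziter X T j ` X \<subseteq> X" for j
    using continuous_map_image_subset_topspace[OF zc] by simp
  have "(f \<circ> ziter X T j) \<in> borel_measurable \<mu>" for j
    using assms(5) continuous_map_compose[OF zc assms(12)]
    by (rule borel_measurable_continuous_map)
  then have Avg_meas: "Avg X T (F k) a f \<in> borel_measurable \<mu>" for k
    unfolding Avg_def comp_def by measurable
  have CX: "C k \<subseteq> X" if "k \<ge> 1" for k
    using assms(5) assms(10)[OF that] sets.sets_into_space[of "C k" \<mu>]
    by (simp add: borel_measure_on_def)
  \<comment> \<open>The bound \<open>B\<close> on \<open>f\<close> controls the exceptional terms;
    it is taken positive because \<epsilon> is divided by it below.\<close>
  have "compactin euclidean (f ` X)"
    using image_compactin[OF _ assms(12)] assms(2) by (simp add: compact_space_def)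
  then have "bounded (f ` X)" by (simp add: compact_imp_bounded)
  then obtain B where "0 < B" and B: "\<And>x. x \<in> X \<Longrightarrow> cmod (f x) \<le> B"
    by (auto simp: bounded_pos)
  obtain S where "0 \<le> S"
    and S: "\<And>k. k \<ge> 1 \<Longrightarrow> (\<Sum>j\<in>F k. cmod (a j)) / real (card (F k)) \<le> S"
    using M_space_bound[OF assms(9)] by blast
  show ?thesis
  proof (rule tendstoI)
    fix \<epsilon> :: real assume "0 < \<epsilon>"
    \<comment> \<open>Using \<open>S + 1\<close> avoids division by zero when \<open>S = 0\<close>
      and still gives \<open>e * S\<close> at most \<epsilon>/2.\<close>
    define e where "e = \<epsilon> / (2 * (S + 1))"
    have "0 < e" using \<open>0 < \<epsilon>\<close> \<open>0 \<le> S\<close> by (simp add: e_def)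
    obtain \<delta> where "0 < \<delta>" and \<delta>: "\<And>x y. \<lbrakk>x \<in> X; y \<in> X; p x y \<le> \<delta>\<rbrakk> \<Longrightarrow> dist (f x) (f y) < e"
      using compact_pm_uniformly_continuous[OF assms(2,12) \<open>0 < e\<close>] by blast
    let ?P = "\<lambda>k j. orbit_dev X p T x0 j (pm_diam p (C k)) > \<delta>"
    let ?R = "\<lambda>k. (\<Sum>j \<in> {j \<in> F k. ?P k j}. cmod (a j)) / real (card (F k))"
    \<comment> \<open>The crude bound on a difference of two values of \<open>f\<close> is
      \<open>2 * B\<close>, so this threshold keeps the exceptional contribution below
      \<epsilon>/2.\<close>
    have "\<forall>\<^sub>F k in sequentially. ?R k < \<epsilon> / (4 * B)"
      using order_tendstoD(2)[OF assms(11)[OF \<open>0 < \<delta>\<close>]] \<open>0 < \<epsilon>\<close> \<open>0 < B\<close> by simp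
    then show "\<forall>\<^sub>F k in sequentially.
        dist (cmod (Avg X T (F k) a f x0 - set_avg \<mu> (C k) (Avg X T (F k) a f))) 0 < \<epsilon>"
      \<comment> \<open>Nothing is known about \<open>F 0\<close> and \<open>C 0\<close>.\<close>
      using eventually_ge_at_top[of 1]
    proof eventually_elim
      fix k :: nat assume R: "?R k < \<epsilon> / (4 * B)" and k: "k \<ge> 1"
      have "cmod (Avg X T (F k) a f x0 - Avg X T (F k) a f x) \<le> e * S + 2 * B * ?R k"
        if x: "x \<in> C k" for x
      proof -
        have xX: "x \<in> X" using CX k x by blast
        have "p x0 x \<le> pm_diam p (C k)"
          using le_pm_diam[OF assms(2) CX[OF k]] assms(10)[OF k] x by blast
        then have dev: "p (ziter X T j x0) (ziter X T j x)
            \<le> orbit_dev X p T x0 j (pm_diam p (C k))" for j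
          using le_orbit_dev[OF assms(2) zX assms(7) xX] by blast
        have X': "ziter X T j x0 \<in> X" "ziter X T j x \<in> X" for j
          using zX[of j] assms(7) xX by blast+
        \<comment> \<open>For a non-exceptional \<open>j\<close>, \<open>dev\<close> places the two
          orbit points within \<delta> of each other, where uniform continuity applies.\<close>
        have "cmod (f (ziter X T j x0) - f (ziter X T j x)) \<le> e" if "\<not> ?P k j" for j
          using \<delta>[OF X'[of j]] dev[of j] that by (simp add: dist_norm less_imp_le)
        moreover have "cmod (f (ziter X T j x0) - f (ziter X T j x)) \<le> 2 * B" for j
          using norm_triangle_ineq4[of "f (ziter X T j x0)" "f (ziter X T j x)"]
            B[OF X'(1)[of j]] B[OF X'(2)[of j]] by linarith
        ultimately have "cmod (Avg X T (F k) a f x0 - Avg X T (F k) a f x)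
            \<le> e * ((\<Sum>j\<in>F k. cmod (a j)) / real (card (F k))) + 2 * B * ?R k"
          using assms(8)[OF k] \<open>0 < e\<close> by (intro cmod_Avg_diff_le) auto
        also have "\<dots> \<le> e * S + 2 * B * ?R k"
          using S[OF k] \<open>0 < e\<close> by (intro add_right_mono mult_left_mono) auto
        finally show ?thesis .
      qed
      then have "cmod (Avg X T (F k) a f x0 - set_avg \<mu> (C k) (Avg X T (F k) a f))
          \<le> e * S + 2 * B * ?R k"
        using assms(10)[OF k] Avg_meas by (intro cmod_diff_set_avg_le) auto
      also have "\<dots> < \<epsilon> / 2 + \<epsilon> / 2"
      proof (rule add_le_less_mono)
        show "e * S \<le> \<epsilon> / 2"
          using \<open>0 < \<epsilon>\<close> \<open>0 \<le> S\<close> by (simp add: e_def field_simps)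
        show "2 * B * ?R k < \<epsilon> / 2"
          using mult_strict_left_mono[OF R, of "2 * B"] \<open>0 < B\<close> by simp
      qed
      finally show "dist (cmod (Avg X T (F k) a f x0 - set_avg \<mu> (C k) (Avg X T (F k) a f))) 0 < \<epsilon>"
        by simp
    qed
  qed
qed

end
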